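(* There exists a function $\varepsilon:\{2,3,4,\ldots\}\to\mathbb{R}$ with $\lim_{d\to\infty}\varepsilon(d)=0$ such that for every integer $d\ge 2$, every real $\alpha$ with $0\le\alpha\le d-1$, and every centrally symmetric convex body $B\subset\mathbb{R}^d$, $$g_\alpha(B)\le 2^d(d-\alpha)\bigl(\ln d+\ln\ln d+2+\varepsilon(d)\bigr).$$
   Context: A convex body $B\subset\mathbb{R}^d$ is a compact convex set with non-empty interior. For real $\alpha\ge 0$, $$g_\alpha(B)=\inf\left\{\sum_{i=1}^k \lambda_i^\alpha : k\in\mathbb{N},\ B\subseteq \bigcup_{i=1}^k(\lambda_i B+x_i),\ \lambda_i\in(0,1),\ x_i\in\mathbb{R}^d\right\}.$$ *)

theory Defs
  imports "HOL-Analysis.Analysis"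
begin

text \<open>The dimension is quantified inside the statement, so it cannot be a type. Points of
  \<open>\<real>\<^sup>d\<close> are therefore the elements of \<^term>\<open>topspace (Euclidean_space d)\<close>, that is, the functions
  \<^typ>\<open>nat \<Rightarrow> real\<close> that vanish at all indices \<open>\<ge> d\<close>. Functions are not an instance of
  \<^class>\<open>real_vector\<close>, so linear combinations are written coordinatewise.\<close>

definition convex_body :: "nat \<Rightarrow> (nat \<Rightarrow> real) set \<Rightarrow> bool" where
  "convex_body d B \<longleftrightarrow>
     compactin (Euclidean_space d) B \<and>
     (\<forall>x\<in>B. \<forall>y\<in>B. \<forall>u\<ge>0. \<forall>v\<ge>0. u + v = 1 \<longrightarrow> (\<lambda>i. u * x i + v * y i) \<in> B) \<and>
     Euclidean_space d interior_of B \<noteq> {}"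

text \<open>The centre of symmetry is not required to be the origin.\<close>

definition centrally_symmetric :: "nat \<Rightarrow> (nat \<Rightarrow> real) set \<Rightarrow> bool" where
  "centrally_symmetric d B \<longleftrightarrow>
     (\<exists>c\<in>topspace (Euclidean_space d). \<forall>x\<in>B. (\<lambda>i. 2 * c i - x i) \<in> B)"

definition homothet :: "real \<Rightarrow> (nat \<Rightarrow> real) \<Rightarrow> (nat \<Rightarrow> real) set \<Rightarrow> (nat \<Rightarrow> real) set" where
  "homothet t v B = (\<lambda>x i. t * x i + v i) ` B"

definition cover_costs :: "nat \<Rightarrow> real \<Rightarrow> (nat \<Rightarrow> real) set \<Rightarrow> real set" where
  "cover_costs d \<alpha> B =
     {(\<Sum>i<k. t i powr \<alpha>) | (k :: nat) (t :: nat \<Rightarrow> real) (v :: nat \<Rightarrow> nat \<Rightarrow> real).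
        (\<forall>i<k. 0 < t i \<and> t i < 1 \<and> v i \<in> topspace (Euclidean_space d)) \<and>
        B \<subseteq> (\<Union>i<k. homothet (t i) (v i) B)}"

text \<open>Real \<^term>\<open>Inf\<close> is the true infimum only for a nonempty set that is bounded below. The costs
  are nonnegative, and for a convex body in dimension \<open>d \<ge> 1\<close> a finite cover by smaller homothets
  exists by compactness.\<close>

definition g :: "nat \<Rightarrow> real \<Rightarrow> (nat \<Rightarrow> real) set \<Rightarrow> real" where
  "g d \<alpha> B = Inf (cover_costs d \<alpha> B)"

lemma bdd_below_cover_costs: "bdd_below (cover_costs d \<alpha> B)"
  unfolding bdd_below_def cover_costs_def by (auto intro!: exI[of _ 0] sum_nonneg)

end

theory Submission
  imports Defs "HOL-Real_Asymp.Real_Asymp"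
begin

text \<open>The idea is Rogers's covering argument, with one change that brings in the factor \<open>d - \<alpha>\<close>: the
  part that remains uncovered is not absorbed into the large homothets but is covered by small
  homothets, which are cheap because a homothet of ratio \<open>\<lambda>\<close> only costs \<open>\<lambda> powr \<alpha>\<close>.

  Let \<open>K\<close> be the body, centred at the origin, and think of it as the unit ball of a norm. A random
  ball of radius \<open>\<mu>\<close> slightly below 1 that can meet \<open>K\<close> covers a given point with probability
  \<open>p\<close>, about \<open>1 / 2 ^ d\<close>. This ratio of volumes is the source of the factor \<open>2 ^ d\<close>, and it is where
  central symmetry is used. Hence for every subset some ball covers at least the fraction \<open>p\<close> of
  it (\<open>exists_good_translate\<close>), and \<open>M\<close> greedily chosen balls leave at most the fraction
  \<open>(1 - p) ^ M \<le> exp (- p M)\<close> of the volume (\<open>greedy_translates\<close>).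

  With \<open>M\<close> about \<open>(d - \<alpha>) ln (1 / \<delta>) / p\<close> this fraction is \<open>\<delta> powr (d - \<alpha>)\<close>. A small volume does not
  yet say that few small balls cover the rest. This is ensured by enlarging the \<open>M\<close> balls by
  \<open>\<delta>\<close>: points outside the enlarged balls that are more than \<open>2 \<delta>\<close> apart carry disjoint
  \<open>\<delta>\<close>-balls inside the small uncovered volume (\<open>card_separated_le\<close>). So balls of radius
  \<open>2 \<delta>\<close> around a maximal such set finish the cover (\<open>exists_two_scale_cover\<close>), and their total cost
  is only \<open>2 powr \<alpha> * (1 + \<delta>) ^ d\<close>, less than the cost of the big balls by a factor of at least the order
  of \<open>(d - \<alpha>) ln (1 / \<delta>)\<close> (\<open>exists_cheap_cover\<close>). The choice of \<open>\<delta>\<close> near \<open>1 / (d ln d)\<close> then gives the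
  theorem.\<close>

section \<open>Lebesgue measure on the coordinate space\<close>

text \<open>Lebesgue measure on the coordinate space, carried by the type of all sequences: the product
  measure is pushed forward by padding with zeros. In this form the topology, the Borel sets and
  the homothets are those of one fixed type, for every \<open>d\<close>.\<close>

definition vol :: "nat \<Rightarrow> (nat \<Rightarrow> real) measure" where
  "vol d = distr (Pi\<^sub>M {..<d} (\<lambda>_. lborel)) borel (\<lambda>f i. if i < d then f i else 0)"

abbreviation E :: "nat \<Rightarrow> (nat \<Rightarrow> real) set" where
  "E d \<equiv> topspace (Euclidean_space d)"

lemma E_iff: "x \<in> E d \<longleftrightarrow> (\<forall>i\<ge>d. x i = 0)"
  by (simp add: topspace_Euclidean_space)

lemma sets_vol [simp, measurable_cong]: "sets (vol d) = sets borel"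
  and space_vol [simp]: "space (vol d) = UNIV"
  by (simp_all add: vol_def)

lemma measurable_pad [measurable]:
  "(\<lambda>f i. if i < d then f i else 0) \<in> Pi\<^sub>M {..<d} (\<lambda>_. lborel) \<rightarrow>\<^sub>M (borel :: (nat \<Rightarrow> real) measure)"
proof -
  have "(\<lambda>f i. if i < d then f i else 0) \<in> Pi\<^sub>M {..<d} (\<lambda>_. lborel) \<rightarrow>\<^sub>M Pi\<^sub>M UNIV (\<lambda>_. borel :: real measure)"
  proof (rule measurable_PiM_single')
    show "(\<lambda>f. if i < d then f i else 0) \<in> borel_measurable (Pi\<^sub>M {..<d} (\<lambda>_. lborel :: real measure))" for i
      by (cases "i < d") auto
  qed auto
  then show ?thesis
    using measurable_cong_sets[OF refl sets_PiM_equal_borel] by blast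
qed

interpretation lborels: product_sigma_finite "\<lambda>_. lborel :: real measure"
  by standard

lemma borel_box:
  fixes X :: "nat \<Rightarrow> real set"
  assumes "\<And>i. X i \<in> sets borel"
  shows "Pi\<^sub>E UNIV X \<in> sets borel"
proof -
  have "Pi\<^sub>E UNIV X = (\<Inter>i. (\<lambda>x. x i) -` X i)"
    by (auto simp: PiE_iff)
  moreover have "(\<lambda>x. x i) -` X i \<in> sets borel" for i
    using measurable_sets[OF borel_measurable_continuous_onI[OF continuous_on_product_coordinates] assms, of i i]
    by simp
  ultimately show ?thesis
    by (auto intro!: sets.countable_INT')
qed

lemma emeasure_vol_box:
  assumes X: "\<And>i. X i \<in> sets borel" and 0: "\<And>i. d \<le> i \<Longrightarrow> 0 \<in> X i"
  shows "emeasure (vol d) (Pi\<^sub>E UNIV X) = (\<Prod>i<d. emeasure lborel (X i))"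
proof -
  have "emeasure (vol d) (Pi\<^sub>E UNIV X) = emeasure (Pi\<^sub>M {..<d} (\<lambda>_. lborel))
      ((\<lambda>f i. if i < d then f i else 0) -` Pi\<^sub>E UNIV X \<inter> space (Pi\<^sub>M {..<d} (\<lambda>_. lborel)))"
    unfolding vol_def by (rule emeasure_distr) (auto intro: borel_box X)
  also have "(\<lambda>f i. if i < d then f i else 0) -` Pi\<^sub>E UNIV X \<inter> space (Pi\<^sub>M {..<d} (\<lambda>_. lborel)) = Pi\<^sub>E {..<d} X"
  proof -
    have "(\<forall>i. (if i < d then f i else 0) \<in> X i) \<longleftrightarrow> (\<forall>i\<in>{..<d}. f i \<in> X i)" for f :: "nat \<Rightarrow> real"
      using 0 by (metis lessThan_iff not_less)
    then show ?thesis
      by (auto simp only: set_eq_iff space_PiM PiE_iff vimage_eq Int_iff space_lborel space_borel UNIV_I extensional_UNIV)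
  qed
  also have "emeasure (Pi\<^sub>M {..<d} (\<lambda>_. lborel)) \<dots> = (\<Prod>i<d. emeasure lborel (X i))"
    by (rule lborels.emeasure_PiM) (auto intro: X)
  finally show ?thesis .
qed

lemma sigma_finite_vol: "sigma_finite_measure (vol d)"
proof
  define A :: "nat \<Rightarrow> (nat \<Rightarrow> real) set" where
    "A n = Pi\<^sub>E UNIV (\<lambda>i. if i < d then {- real n..real n} else UNIV)" for n
  have "emeasure (vol d) (A n) \<noteq> \<infinity>" for n
    unfolding A_def by (subst emeasure_vol_box) (auto simp: power_eq_top_ennreal)
  moreover have "A n \<in> sets borel" for n
    unfolding A_def by (rule borel_box) auto
  moreover have "x \<in> (\<Union>n. A n)" for x
  proof -
    obtain n where n: "(\<Sum>i<d. \<bar>x i\<bar>) \<le> real n"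
      using real_arch_simple by blast
    have "\<bar>x i\<bar> \<le> real n" if "i < d" for i
      using member_le_sum[of i "{..<d}" "\<lambda>i. \<bar>x i\<bar>"] that n by simp
    then have "x \<in> A n"
      by (fastforce simp: A_def PiE_iff abs_le_iff)
    then show ?thesis by blast
  qed
  ultimately show "\<exists>A. countable A \<and> A \<subseteq> sets (vol d) \<and> \<Union> A = space (vol d) \<and> (\<forall>a\<in>A. emeasure (vol d) a \<noteq> \<infinity>)"
    by (intro exI[of _ "range A"]) auto
qed

lemma continuous_affine:
  "continuous_on UNIV (\<lambda>(x::nat \<Rightarrow> real) i. t * x i + v i)"
  by (intro continuous_on_coordinatewise_then_product continuous_intros continuous_on_product_coordinates)

lemma measurable_affine [measurable]:
  "(\<lambda>(x::nat \<Rightarrow> real) i. t * x i + v i) \<in> borel_measurable borel"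
  by (rule borel_measurable_continuous_onI[OF continuous_affine])

lemma mem_homothet: "x \<in> homothet t v S \<longleftrightarrow> (\<exists>k\<in>S. x = (\<lambda>i. t * k i + v i))"
  by (auto simp: homothet_def)

lemma homothet_eq_vimage:
  assumes "t \<noteq> 0"
  shows "homothet t v S = (\<lambda>x i. (1/t) * x i + (- v i / t)) -` S"
proof -
  have "x \<in> homothet t v S \<longleftrightarrow> (\<lambda>i. (1/t) * x i + (- v i / t)) \<in> S" for x
  proof
    assume "x \<in> homothet t v S"
    then show "(\<lambda>i. (1/t) * x i + (- v i / t)) \<in> S"
      using assms by (auto simp: homothet_def field_simps)
  next
    assume "(\<lambda>i. (1/t) * x i + (- v i / t)) \<in> S"
    moreover have "x = (\<lambda>i. t * ((1/t) * x i + (- v i / t)) + v i)"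
      using assms by (auto simp: field_simps)
    ultimately show "x \<in> homothet t v S"
      unfolding homothet_def by (intro image_eqI)
  qed
  then show ?thesis by auto
qed

lemma sets_homothet [measurable]:
  assumes "t \<noteq> 0" "S \<in> sets borel"
  shows "homothet t v S \<in> sets borel"
  unfolding homothet_eq_vimage[OF assms(1)]
  using measurable_sets[OF measurable_affine[of "1/t" "\<lambda>i. - v i / t"] assms(2)] by simp

text \<open>Both sides are image measures of product measures, and a product measure is determined by its
  values on boxes. There the claim splits into the one-dimensional scaling law in each coordinate.
  The translation has to stay inside the coordinate space, since the measure lives only there.\<close>

lemma vol_affine:
  assumes t: "t > 0" and v: "v \<in> E d"
  shows "vol d = density (distr (vol d) borel (\<lambda>x i. t * x i + v i)) (\<lambda>_. ennreal (t ^ d))"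
proof -
  let ?P = "Pi\<^sub>M {..<d} (\<lambda>_. lborel :: real measure)"
  define h where "h = (\<lambda>x. \<lambda>i\<in>{..<d}. t * x i + v i)"
  have h [measurable]: "h \<in> ?P \<rightarrow>\<^sub>M ?P"
    unfolding h_def by measurable
  have P: "density (distr ?P ?P h) (\<lambda>_. ennreal (t ^ d)) = ?P"
  proof (rule lborels.PiM_eqI)
    fix A :: "nat \<Rightarrow> real set" assume A: "\<And>i. i \<in> {..<d} \<Longrightarrow> A i \<in> sets lborel"
    have A' [measurable]: "Pi\<^sub>E {..<d} A \<in> sets ?P"
      using A by (intro sets_PiM_I_finite) auto
    have B: "(\<lambda>x. v i + t * x) -` A i \<in> sets borel" if "i < d" for i
    proof -
      have "(\<lambda>x. v i + t * x) \<in> borel \<rightarrow>\<^sub>M borel" by measurable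
      then show ?thesis
        using measurable_sets[of "\<lambda>x. v i + t * x" borel borel "A i"] A that by simp
    qed
    have one: "ennreal t * emeasure lborel ((\<lambda>x. v i + t * x) -` A i) = emeasure lborel (A i)"
      if "i < d" for i
    proof -
      have "emeasure lborel (A i) = emeasure (density (distr lborel borel (\<lambda>x. v i + t * x)) (\<lambda>_. ennreal \<bar>t\<bar>)) (A i)"
        using lborel_real_affine[of t "v i"] t by simp
      also have "\<dots> = ennreal t * emeasure lborel ((\<lambda>x. v i + t * x) -` A i)"
        using A that t by (simp add: emeasure_density_const emeasure_distr)
      finally show ?thesis by simp
    qed
    have "emeasure (density (distr ?P ?P h) (\<lambda>_. ennreal (t ^ d))) (Pi\<^sub>E {..<d} A) =
        ennreal (t ^ d) * emeasure ?P (h -` Pi\<^sub>E {..<d} A \<inter> space ?P)"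
      by (simp add: emeasure_density_const emeasure_distr A')
    also have "h -` Pi\<^sub>E {..<d} A \<inter> space ?P = Pi\<^sub>E {..<d} (\<lambda>i. (\<lambda>x. v i + t * x) -` A i)"
      by (auto simp: h_def space_PiM PiE_iff add.commute)
    also have "emeasure ?P \<dots> = (\<Prod>i<d. emeasure lborel ((\<lambda>x. v i + t * x) -` A i))"
      using B by (intro lborels.emeasure_PiM) auto
    also have "ennreal (t ^ d) * \<dots> = (\<Prod>i<d. ennreal t * emeasure lborel ((\<lambda>x. v i + t * x) -` A i))"
      using t by (simp add: prod.distrib ennreal_power)
    also have "\<dots> = (\<Prod>i<d. emeasure lborel (A i))"
      using one by (intro prod.cong) auto
    finally show "emeasure (density (distr ?P ?P h) (\<lambda>_. ennreal (t ^ d))) (Pi\<^sub>E {..<d} A) =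
      (\<Prod>i\<in>{..<d}. emeasure lborel (A i))" .
  qed auto
  let ?pad = "\<lambda>f i. if i < d then f i else 0 :: real"
  have comm: "(\<lambda>x i. t * x i + v i) \<circ> ?pad = ?pad \<circ> h"
    using v by (auto simp: h_def E_iff fun_eq_iff)
  show ?thesis
  proof (rule measure_eqI)
    fix S assume "S \<in> sets (vol d)"
    then have S [measurable]: "S \<in> sets borel" by simp
    have [measurable]: "?pad -` S \<inter> space ?P \<in> sets ?P"
      by measurable
    have [measurable]: "(\<lambda>x i. t * x i + v i) -` S \<in> sets borel"
      using measurable_sets[OF measurable_affine S] by simp
    have "emeasure (density (distr (vol d) borel (\<lambda>x i. t * x i + v i)) (\<lambda>_. ennreal (t ^ d))) S
        = ennreal (t ^ d) * emeasure ?P (((\<lambda>x i. t * x i + v i) \<circ> ?pad) -` S \<inter> space ?P)"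
      by (simp add: emeasure_density_const emeasure_distr vol_def vimage_comp)
    also have "\<dots> = ennreal (t ^ d) * emeasure ?P (h -` (?pad -` S \<inter> space ?P) \<inter> space ?P)"
      unfolding comm using measurable_space[OF h]
      by (intro arg_cong[where f = "\<lambda>A. ennreal (t ^ d) * emeasure ?P A"]) auto
    also have "\<dots> = emeasure (density (distr ?P ?P h) (\<lambda>_. ennreal (t ^ d))) (?pad -` S \<inter> space ?P)"
      by (simp add: emeasure_density_const emeasure_distr)
    also have "\<dots> = emeasure (vol d) S"
      unfolding P by (simp add: vol_def emeasure_distr)
    finally show "emeasure (vol d) S = emeasure (density (distr (vol d) borel (\<lambda>x i. t * x i + v i)) (\<lambda>_. ennreal (t ^ d))) S"
      by simp
  qed simp
qed

lemma emeasure_vol_homothet: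
  assumes t: "t > 0" and v: "v \<in> E d" and S [measurable]: "S \<in> sets borel"
  shows "emeasure (vol d) (homothet t v S) = ennreal (t ^ d) * emeasure (vol d) S"
proof -
  have "inj (\<lambda>(x::nat\<Rightarrow>real) i. t * x i + v i)"
    using t by (auto simp: inj_def fun_eq_iff)
  then have *: "(\<lambda>x i. t * x i + v i) -` homothet t v S = S"
    unfolding homothet_def by (rule inj_vimage_image_eq)
  have "homothet t v S \<in> sets borel" using t S by (auto intro: sets_homothet)
  then show ?thesis
    using t by (subst vol_affine[OF t v]) (simp add: emeasure_density_const emeasure_distr *)
qed

section \<open>Symmetric bodies and the averaging argument\<close>

text \<open>The first moment principle: were \<open>f\<close> below \<open>c\<close> on all of \<open>S\<close>, its integral over \<open>S\<close> would be
  strictly smaller than \<open>c\<close> times the measure of \<open>S\<close>.\<close>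

lemma nn_integral_ge_average:
  fixes f :: "'a \<Rightarrow> ennreal"
  assumes f [measurable]: "f \<in> borel_measurable M" and S [measurable]: "S \<in> sets M"
    and S0: "emeasure M S \<noteq> 0" and S1: "emeasure M S < \<infinity>" and c: "c < \<infinity>"
    and le: "c * emeasure M S \<le> (\<integral>\<^sup>+x. f x * indicator S x \<partial>M)"
  shows "\<exists>x\<in>S. c \<le> f x"
proof (rule ccontr)
  assume "\<not> (\<exists>x\<in>S. c \<le> f x)"
  then have lt: "f x < c" if "x \<in> S" for x
    using that by (auto simp: not_le)
  have cS: "(\<integral>\<^sup>+x. c * indicator S x \<partial>M) = c * emeasure M S"
    by (rule nn_integral_cmult_indicator) (rule S)
  have fin: "c * emeasure M S < \<infinity>"
    using S1 c by (simp add: ennreal_mult_less_top)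
  have mono: "(\<integral>\<^sup>+x. f x * indicator S x \<partial>M) \<le> c * emeasure M S"
    unfolding cS[symmetric] by (intro nn_integral_mono) (auto split: split_indicator dest!: lt)
  have "(\<integral>\<^sup>+x. f x * indicator S x \<partial>M) < (\<integral>\<^sup>+x. c * indicator S x \<partial>M)"
  proof (rule nn_integral_less)
    show "(\<integral>\<^sup>+x. f x * indicator S x \<partial>M) \<noteq> \<infinity>"
      using mono fin by (metis leD)
    show "AE x in M. f x * indicator S x \<le> c * indicator S x"
      by (rule AE_I2) (auto split: split_indicator dest!: lt)
    show "\<not> (AE x in M. c * indicator S x \<le> f x * indicator S x)"
    proof
      assume "AE x in M. c * indicator S x \<le> f x * indicator S x"
      then have "AE x in M. x \<notin> S"
      proof (rule AE_mp, intro AE_I2 impI notI)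
        fix x assume "c * indicator S x \<le> f x * indicator S x" "x \<in> S"
        then show False using lt[of x] by simp
      qed
      then have "emeasure M S = 0"
        using AE_iff_measurable[OF S, of "\<lambda>x. x \<notin> S"] sets.sets_into_space[OF S] by auto
      with S0 show False ..
    qed
  qed measurable
  with le cS show False by simp
qed

text \<open>The covering argument uses only these properties of a convex body centred at the origin; the
  topology enters only through measurability and the two bounds on the volume. The sets
  \<open>homothet t x K\<close> play the role of the balls of radius \<open>t\<close> in the norm with unit ball \<open>K\<close>, and the
  geometric lemmas below are instances of its triangle inequality.\<close>

locale symmetric_body =
  fixes d :: nat and K :: "(nat \<Rightarrow> real) set"
  assumes subset_E: "K \<subseteq> E d"
    and borel_K [measurable]: "K \<in> sets borel"
    and convex_K: "\<And>x y u v. x \<in> K \<Longrightarrow> y \<in> K \<Longrightarrow> u \<ge> 0 \<Longrightarrow> v \<ge> 0 \<Longrightarrow> u + v = 1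
      \<Longrightarrow> (\<lambda>i. u * x i + v * y i) \<in> K"
    and symmetric_K: "\<And>x. x \<in> K \<Longrightarrow> (\<lambda>i. - x i) \<in> K"
    and vol_pos: "emeasure (vol d) K > 0"
    and vol_finite: "emeasure (vol d) K < \<infinity>"
begin

abbreviation dilate :: "real \<Rightarrow> (nat \<Rightarrow> real) set" where
  "dilate t \<equiv> homothet t (\<lambda>_. 0) K"

lemma dilate_add:
  assumes "a \<in> K" "b \<in> K" "s > 0" "t > 0"
  shows "\<exists>c\<in>K. \<forall>i. s * a i + t * b i = (s + t) * c i"
proof
  show "(\<lambda>i. s / (s + t) * a i + t / (s + t) * b i) \<in> K"
    using assms by (intro convex_K) (auto simp: add_divide_distrib[symmetric])
  show "\<forall>i. s * a i + t * b i = (s + t) * (s / (s + t) * a i + t / (s + t) * b i)"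
    using assms by (simp add: distrib_left add_pos_pos[THEN less_imp_neq, THEN not_sym])
qed

lemma homothet_subset_E:
  assumes "v \<in> E d"
  shows "homothet t v K \<subseteq> E d"
  using assms subset_E by (fastforce simp: E_iff homothet_def)

lemma homothet_sym:
  "y \<in> homothet t x K \<longleftrightarrow> x \<in> homothet t y K"
proof -
  have "x \<in> homothet t y K" if yx: "y \<in> homothet t x K" for x y
  proof -
    obtain k where k: "k \<in> K" "y = (\<lambda>i. t * k i + x i)"
      using yx by (auto simp: mem_homothet)
    then show ?thesis
      unfolding mem_homothet using symmetric_K[OF k(1)]
      by (intro bexI[of _ "\<lambda>i. - k i"]) auto
  qed
  then show ?thesis by blast
qed

lemma homothet_subset_dilate:
  assumes "y \<in> dilate s" "s > 0" "t > 0"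
  shows "homothet t y K \<subseteq> dilate (s + t)"
proof
  fix x assume "x \<in> homothet t y K"
  with assms(1) obtain a b where "a \<in> K" "b \<in> K" "x = (\<lambda>i. t * b i + s * a i)"
    by (auto simp: mem_homothet)
  then show "x \<in> dilate (s + t)"
    using dilate_add[of a b s t] assms by (fastforce simp: mem_homothet add.commute)
qed

text \<open>Used twice in the packing argument: small balls around points that are far apart
  are disjoint, and a small ball around a point outside an enlarged ball misses the original one.\<close>

lemma homothets_meet:
  assumes "z \<in> homothet s x K" "z \<in> homothet t y K" "s > 0" "t > 0"
  shows "y \<in> homothet (s + t) x K"
proof -
  obtain a where a: "a \<in> K" "z = (\<lambda>i. s * a i + x i)"
    using assms by (auto simp: mem_homothet)
  obtain b where b: "b \<in> K" "y = (\<lambda>i. t * b i + z i)"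
    using homothet_sym[THEN iffD1, OF assms(2)] by (auto simp: mem_homothet)
  obtain c where "c \<in> K" "\<forall>i. s * a i + t * b i = (s + t) * c i"
    using dilate_add a b assms by blast
  then show ?thesis
    unfolding mem_homothet a b by (intro bexI[of _ c]) (auto simp: fun_eq_iff algebra_simps)
qed

lemma dilate_1: "dilate 1 = K"
  by (auto simp: homothet_def)

lemma emeasure_homothet:
  "t > 0 \<Longrightarrow> v \<in> E d \<Longrightarrow> emeasure (vol d) (homothet t v K) = ennreal (t ^ d) * emeasure (vol d) K"
  by (rule emeasure_vol_homothet) auto

lemma zero_E: "(\<lambda>_. 0) \<in> E d"
  by (simp add: E_iff)

lemma emeasure_subset_dilate:
  assumes "U \<subseteq> dilate t" "t > 0"
  shows "emeasure (vol d) U < \<infinity>"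
proof -
  have "emeasure (vol d) U \<le> emeasure (vol d) (dilate t)"
    using assms by (intro emeasure_mono) (auto intro: sets_homothet borel_K)
  also have "\<dots> < \<infinity>"
    using vol_finite assms(2) by (simp add: emeasure_homothet zero_E ennreal_mult_less_top)
  finally show ?thesis .
qed

lemma measurable_homothet_rel:
  assumes "t > 0"
  shows "{(x, y). y \<in> homothet t x K} \<in> sets (vol d \<Otimes>\<^sub>M vol d)"
proof -
  have "continuous_on UNIV (\<lambda>(z :: (nat \<Rightarrow> real) \<times> (nat \<Rightarrow> real)) i. (snd z i - fst z i) / t)"
  proof (intro continuous_on_coordinatewise_then_product continuous_intros)
    fix i
    show "continuous_on UNIV (\<lambda>z :: (nat \<Rightarrow> real) \<times> (nat \<Rightarrow> real). snd z i)"
      by (rule continuous_on_compose2[OF continuous_on_product_coordinates[of i] continuous_on_snd[OF continuous_on_id]]) auto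
    show "continuous_on UNIV (\<lambda>z :: (nat \<Rightarrow> real) \<times> (nat \<Rightarrow> real). fst z i)"
      by (rule continuous_on_compose2[OF continuous_on_product_coordinates[of i] continuous_on_fst[OF continuous_on_id]]) auto
  qed (use assms in auto)
  then have "(\<lambda>(z :: (nat \<Rightarrow> real) \<times> (nat \<Rightarrow> real)) i. (snd z i - fst z i) / t) -` K \<in> sets borel"
    using measurable_sets[OF borel_measurable_continuous_onI borel_K] by fastforce
  moreover have "{(x, y). y \<in> homothet t x K} = (\<lambda>(z :: (nat \<Rightarrow> real) \<times> (nat \<Rightarrow> real)) i. (snd z i - fst z i) / t) -` K"
    using assms by (auto simp: homothet_eq_vimage diff_divide_distrib)
  moreover have "sets (vol d \<Otimes>\<^sub>M vol d) = sets borel"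
    unfolding borel_prod[symmetric] by (intro sets_pair_measure_cong) auto
  ultimately show ?thesis
    by simp
qed

text \<open>Let \<open>x\<close> range uniformly over \<open>dilate (s + t)\<close>. For a fixed \<open>y\<close> in \<open>U\<close> the \<open>x\<close> whose translate of
  \<open>dilate t\<close> contains \<open>y\<close> form the set \<open>homothet t y K\<close>, which lies inside \<open>dilate (s + t)\<close>. So each
  \<open>y\<close> is covered with probability \<open>(t / (s + t)) ^ d\<close>, and by Fubini this is the expected
  fraction of \<open>U\<close> that a random translate covers. Some translate does at least as well.\<close>

lemma exists_good_translate:
  assumes s: "s > 0" and t: "t > 0" and U [measurable]: "U \<in> sets borel" and US: "U \<subseteq> dilate s"
  shows "\<exists>x\<in>E d. ennreal ((t / (s + t)) ^ d) * emeasure (vol d) U \<le> emeasure (vol d) (U \<inter> homothet t x K)"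
proof -
  interpret sigma_finite_measure "vol d" by (rule sigma_finite_vol)
  interpret pair_sigma_finite "vol d" "vol d" ..
  define S where "S = dilate (s + t)"
  \<comment> \<open>The incidence relation between centres and covered points; it is symmetric.\<close>
  define W where "W = {(x, y). y \<in> homothet t x K}"
  have S [measurable]: "S \<in> sets borel"
    unfolding S_def using s t by (intro sets_homothet) auto
  have W [measurable]: "W \<in> sets (vol d \<Otimes>\<^sub>M vol d)"
    unfolding W_def using t by (rule measurable_homothet_rel)
  have emS: "emeasure (vol d) S = ennreal ((s + t) ^ d) * emeasure (vol d) K"
    unfolding S_def using s t by (intro emeasure_homothet zero_E) auto
  have U_fin: "emeasure (vol d) U < \<infinity>"
    using US s by (rule emeasure_subset_dilate)
  define f where "f x = (\<integral>\<^sup>+y. indicator U y * indicator W (x, y) \<partial>vol d)" for x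
  have f_eq: "f x = emeasure (vol d) (U \<inter> homothet t x K)" for x
  proof -
    have "f x = (\<integral>\<^sup>+y. indicator (U \<inter> homothet t x K) y \<partial>vol d)"
      unfolding f_def by (intro nn_integral_cong) (auto simp: W_def split: split_indicator)
    also have "\<dots> = emeasure (vol d) (U \<inter> homothet t x K)"
      using t by (intro nn_integral_indicator) (auto intro!: sets_homothet)
    finally show ?thesis .
  qed
  have [measurable]: "f \<in> borel_measurable (vol d)"
    unfolding f_def by measurable
  have "(\<integral>\<^sup>+x. f x * indicator S x \<partial>vol d) =
      (\<integral>\<^sup>+x. (\<integral>\<^sup>+y. indicator U y * indicator W (x, y) * indicator S x \<partial>vol d) \<partial>vol d)"
    unfolding f_def by (simp add: nn_integral_multc)
  also have "\<dots> = (\<integral>\<^sup>+y. (\<integral>\<^sup>+x. indicator U y * indicator W (x, y) * indicator S x \<partial>vol d) \<partial>vol d)"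
    by (rule Fubini'[symmetric]) measurable
  also have "\<dots> = (\<integral>\<^sup>+y. ennreal (t ^ d) * emeasure (vol d) K * indicator U y \<partial>vol d)"
  proof (rule nn_integral_cong)
    fix y
    show "(\<integral>\<^sup>+x. indicator U y * indicator W (x, y) * indicator S x \<partial>vol d) =
      ennreal (t ^ d) * emeasure (vol d) K * indicator U y"
    proof (cases "y \<in> U")
      case True
      then have yS: "y \<in> dilate s" using US by auto
      then have yE: "y \<in> E d" using homothet_subset_E[OF zero_E] by auto
      have "homothet t y K \<subseteq> S"
        unfolding S_def using yS s t by (rule homothet_subset_dilate)
      then have "(\<integral>\<^sup>+x. indicator U y * indicator W (x, y) * indicator S x \<partial>vol d) =
          (\<integral>\<^sup>+x. indicator (homothet t y K) x \<partial>vol d)"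
        using True homothet_sym by (intro nn_integral_cong) (auto simp: W_def split: split_indicator)
      also have "\<dots> = emeasure (vol d) (homothet t y K)"
        using t by (intro nn_integral_indicator) (auto intro!: sets_homothet)
      finally show ?thesis
        using True t yE by (simp add: emeasure_homothet)
    qed simp
  qed
  also have "\<dots> = ennreal (t ^ d) * emeasure (vol d) K * emeasure (vol d) U"
    by (simp add: nn_integral_cmult)
  also have "ennreal (t ^ d) = ennreal ((t / (s + t)) ^ d) * ennreal ((s + t) ^ d)"
    using s t by (simp add: ennreal_mult[symmetric] power_divide)
  finally have int: "ennreal ((t / (s + t)) ^ d) * emeasure (vol d) U * emeasure (vol d) S =
      (\<integral>\<^sup>+x. f x * indicator S x \<partial>vol d)"
    unfolding emS by (simp add: mult_ac)
  have "\<exists>x\<in>S. ennreal ((t / (s + t)) ^ d) * emeasure (vol d) U \<le> f x"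
  proof (rule nn_integral_ge_average)
    show "emeasure (vol d) S \<noteq> 0"
      using vol_pos s t by (simp add: emS)
    show "emeasure (vol d) S < \<infinity>"
      using s t by (intro emeasure_subset_dilate[of _ "s + t"]) (auto simp: S_def)
    show "ennreal ((t / (s + t)) ^ d) * emeasure (vol d) U < \<infinity>"
      using U_fin by (simp add: ennreal_mult_less_top)
  qed (use int in auto)
  then show ?thesis
    using homothet_subset_E[OF zero_E] unfolding S_def f_eq by blast
qed

text \<open>Choosing the translates one after the other, each good for what is still uncovered, replaces
  the choice of \<open>M\<close> independent random translates and needs no product of probability spaces.\<close>

lemma greedy_translates:
  assumes s: "s > 0" and t: "t > 0"
  shows "\<exists>x. (\<forall>i<M. x i \<in> E d) \<and>
    measure (vol d) (dilate s - (\<Union>i<M. homothet t (x i) K))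
      \<le> (1 - (t / (s + t)) ^ d) ^ M * measure (vol d) (dilate s)"
proof (induction M)
  case 0
  then show ?case by simp
next
  case (Suc M)
  define p where "p = (t / (s + t)) ^ d"
  have p: "0 \<le> p" "p \<le> 1"
    unfolding p_def using s t by (auto intro!: power_le_one)
  from Suc obtain x where x: "\<forall>i<M. x i \<in> E d" and
    le: "measure (vol d) (dilate s - (\<Union>i<M. homothet t (x i) K)) \<le> (1 - p) ^ M * measure (vol d) (dilate s)"
    unfolding p_def by blast
  define U where "U = dilate s - (\<Union>i<M. homothet t (x i) K)"
  have h: "homothet t v K \<in> sets borel" for v
    using t by (intro sets_homothet) auto
  have U [measurable]: "U \<in> sets borel"
    unfolding U_def using h s by (intro sets.Diff sets.finite_UN) (auto intro: sets_homothet)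
  have US: "U \<subseteq> dilate s" by (auto simp: U_def)
  obtain z where z: "z \<in> E d" and
    big: "ennreal p * emeasure (vol d) U \<le> emeasure (vol d) (U \<inter> homothet t z K)"
    using exists_good_translate[OF s t U US] unfolding p_def by blast
  have fin: "emeasure (vol d) V \<noteq> \<infinity>" if "V \<subseteq> U" for V
    using emeasure_subset_dilate[of V s] US s that by force
  have "p * measure (vol d) U \<le> measure (vol d) (U \<inter> homothet t z K)"
    using big fin[of U] fin[of "U \<inter> homothet t z K"] p
    by (simp add: emeasure_eq_ennreal_measure ennreal_mult[symmetric])
  moreover have "measure (vol d) (U - homothet t z K) = measure (vol d) U - measure (vol d) (U \<inter> homothet t z K)"
  proof -
    have "U - homothet t z K = U - U \<inter> homothet t z K" by auto
    then show ?thesis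
      using fin[of U] h[of z] by (simp add: measure_Diff)
  qed
  ultimately have "measure (vol d) (U - homothet t z K) \<le> (1 - p) * measure (vol d) U"
    by (simp add: algebra_simps)
  also have "\<dots> \<le> (1 - p) * ((1 - p) ^ M * measure (vol d) (dilate s))"
    using le p unfolding U_def by (intro mult_left_mono) auto
  finally have "measure (vol d) (U - homothet t z K) \<le> (1 - p) ^ Suc M * measure (vol d) (dilate s)"
    by (simp add: mult_ac)
  moreover have "U - homothet t z K = dilate s - (\<Union>i<Suc M. homothet t ((x(M := z)) i) K)"
    by (auto simp: U_def less_Suc_eq)
  moreover have "\<forall>i<Suc M. (x(M := z)) i \<in> E d"
    using x z by (auto simp: less_Suc_eq)
  ultimately show ?case
    unfolding p_def by metis
qed

end

section \<open>Covering with two sizes of homothets\<close>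

lemma ex_max_card:
  assumes "P {}" "\<And>Y. P Y \<Longrightarrow> card Y \<le> n"
  shows "\<exists>Y. P Y \<and> (\<forall>Z. P Z \<longrightarrow> card Z \<le> card Y)"
  using ex_has_greatest_nat[of P "{}" card "Suc n"] assms by (auto simp: less_Suc_eq_le)

context symmetric_body
begin

text \<open>The usual separation of points by more than \<open>r\<close>, in the norm with unit ball \<open>K\<close>.\<close>

definition separated :: "real \<Rightarrow> (nat \<Rightarrow> real) set \<Rightarrow> bool" where
  "separated r Y \<longleftrightarrow> (\<forall>y\<in>Y. \<forall>z\<in>Y. y \<noteq> z \<longrightarrow> z \<notin> homothet r y K)"

text \<open>The balls of radius \<open>\<delta>\<close> around the points of \<open>Y\<close> are disjoint and meet none of the balls of
  radius \<open>\<mu>\<close>, because the points avoid the balls of the larger radius \<open>\<mu> + \<delta>\<close>. As \<open>Y\<close> lies in \<open>K\<close>, they all lie in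
  the part of \<open>dilate (1 + \<delta>)\<close> left over by the balls of radius \<open>\<mu>\<close>, and comparing volumes bounds
  their number.\<close>

lemma card_separated_le:
  fixes M :: nat
  assumes "finite Y" "separated (2 * \<delta>) Y" and \<delta>: "\<delta> > 0" and \<mu>: "\<mu> > 0"
    and Y: "Y \<subseteq> K - (\<Union>i<M. homothet (\<mu> + \<delta>) (x i) K)"
  shows "real (card Y) * (\<delta> ^ d * measure (vol d) K) \<le>
     measure (vol d) (dilate (1 + \<delta>) - (\<Union>i<M. homothet \<mu> (x i) K))"
proof -
  have sets: "homothet t v K \<in> sets borel" if "t > 0" for t v
    using that by (intro sets_homothet) auto
  have YE: "y \<in> E d" if "y \<in> Y" for y
    using that Y subset_E by auto
  define R where "R = dilate (1 + \<delta>) - (\<Union>i<M. homothet \<mu> (x i) K)"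
  have R: "R \<in> sets borel"
    unfolding R_def using \<delta> \<mu> by (intro sets.Diff sets.finite_UN) (auto intro!: sets)
  have R_fin: "emeasure (vol d) R \<noteq> \<infinity>"
    using emeasure_subset_dilate[of R "1 + \<delta>"] \<delta> by (force simp: R_def)
  have hom_fin: "emeasure (vol d) (homothet \<delta> y K) = ennreal (\<delta> ^ d * measure (vol d) K)" if "y \<in> Y" for y
    using that YE \<delta> vol_finite by (simp add: emeasure_homothet emeasure_eq_ennreal_measure ennreal_mult)
  have "disjoint_family_on (\<lambda>y. homothet \<delta> y K) Y"
    unfolding disjoint_family_on_def
  proof (intro ballI impI equals0I)
    fix y z w assume "y \<in> Y" "z \<in> Y" "y \<noteq> z" "w \<in> homothet \<delta> y K \<inter> homothet \<delta> z K"
    then show False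
      using homothets_meet[of w \<delta> y \<delta> z] \<delta> \<open>separated (2 * \<delta>) Y\<close> by (auto simp: separated_def)
  qed
  then have "measure (vol d) (\<Union>y\<in>Y. homothet \<delta> y K) = (\<Sum>y\<in>Y. measure (vol d) (homothet \<delta> y K))"
    using \<open>finite Y\<close> \<delta> sets hom_fin by (intro measure_finite_Union) auto
  also have "\<dots> = (\<Sum>y\<in>Y. \<delta> ^ d * measure (vol d) K)"
    using hom_fin \<delta> by (intro sum.cong) (auto simp: measure_def)
  also have "\<dots> = real (card Y) * (\<delta> ^ d * measure (vol d) K)"
    by simp
  finally have "real (card Y) * (\<delta> ^ d * measure (vol d) K) = measure (vol d) (\<Union>y\<in>Y. homothet \<delta> y K)"
    by simp
  also have "\<dots> \<le> measure (vol d) R"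
  proof (rule measure_mono_fmeasurable)
    show "(\<Union>y\<in>Y. homothet \<delta> y K) \<subseteq> R"
    proof (intro UN_least subsetI)
      fix y w assume y: "y \<in> Y" and w: "w \<in> homothet \<delta> y K"
      have "y \<in> dilate 1" using y Y dilate_1 by auto
      then have "w \<in> dilate (1 + \<delta>)"
        using homothet_subset_dilate[of y 1 \<delta>] w \<delta> by auto
      moreover have "w \<notin> homothet \<mu> (x i) K" if "i < M" for i
        using homothets_meet[of w \<mu> "x i" \<delta> y] w y Y that \<mu> \<delta> by auto
      ultimately show "w \<in> R" by (auto simp: R_def)
    qed
    show "(\<Union>y\<in>Y. homothet \<delta> y K) \<in> sets (vol d)"
      using \<open>finite Y\<close> \<delta> sets by (auto intro!: sets.finite_UN)
    show "R \<in> fmeasurable (vol d)"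
      using R R_fin by (auto simp: fmeasurable_def less_top)
  qed
  finally show ?thesis unfolding R_def .
qed

text \<open>The greedy choice is made for the radius \<open>\<mu>\<close> and the larger body \<open>dilate (1 + \<delta>)\<close>. The same
  centres are then used with radius \<open>\<mu> + \<delta>\<close>, and what they miss in \<open>K\<close> is covered by balls of
  radius \<open>2 * \<delta>\<close> around a maximal separated set.\<close>

lemma exists_two_scale_cover:
  assumes \<delta>: "\<delta> > 0" and \<mu>: "\<mu> > 0"
  shows "\<exists>x Y. (\<forall>i<M. x i \<in> E d) \<and> finite Y \<and> Y \<subseteq> E d \<and>
    K \<subseteq> (\<Union>i<M. homothet (\<mu> + \<delta>) (x i) K) \<union> (\<Union>y\<in>Y. homothet (2 * \<delta>) y K) \<and>
    real (card Y) \<le> (1 - (\<mu> / (1 + \<delta> + \<mu>)) ^ d) ^ M * ((1 + \<delta>) / \<delta>) ^ d"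
proof -
  define q where "q = (1 - (\<mu> / (1 + \<delta> + \<mu>)) ^ d) ^ M"
  have mK: "measure (vol d) K > 0"
    using vol_pos vol_finite by (simp add: measure_def enn2real_positive_iff)
  obtain x where x: "\<forall>i<M. x i \<in> E d" and
    small: "measure (vol d) (dilate (1 + \<delta>) - (\<Union>i<M. homothet \<mu> (x i) K)) \<le> q * measure (vol d) (dilate (1 + \<delta>))"
    using greedy_translates[of "1 + \<delta>" \<mu> M] \<delta> \<mu> unfolding q_def by auto
  have dil: "measure (vol d) (dilate (1 + \<delta>)) = (1 + \<delta>) ^ d * measure (vol d) K"
    using \<delta> by (simp add: measure_def emeasure_homothet zero_E enn2real_mult)
  define R where "R = K - (\<Union>i<M. homothet (\<mu> + \<delta>) (x i) K)"
  define P where "P Y \<longleftrightarrow> finite Y \<and> Y \<subseteq> R \<and> separated (2 * \<delta>) Y" for Y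
  have bound: "real (card Y) \<le> q * ((1 + \<delta>) / \<delta>) ^ d" if "P Y" for Y
  proof -
    have "real (card Y) * (\<delta> ^ d * measure (vol d) K) \<le>
       measure (vol d) (dilate (1 + \<delta>) - (\<Union>i<M. homothet \<mu> (x i) K))"
      using that \<delta> \<mu> unfolding P_def R_def by (intro card_separated_le) auto
    also have "\<dots> \<le> q * ((1 + \<delta>) ^ d * measure (vol d) K)"
      using small unfolding dil .
    finally have "(real (card Y) * \<delta> ^ d) * measure (vol d) K \<le> (q * (1 + \<delta>) ^ d) * measure (vol d) K"
      by (simp add: mult_ac)
    then have "real (card Y) * \<delta> ^ d \<le> q * (1 + \<delta>) ^ d"
      using mK by simp
    then show ?thesis
      using \<delta> by (simp add: power_divide field_simps)
  qed
  have "\<exists>Y. P Y \<and> (\<forall>Z. P Z \<longrightarrow> card Z \<le> card Y)"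
  proof (rule ex_max_card)
    show "P {}" by (simp add: P_def separated_def)
    show "card Y \<le> nat \<lfloor>q * ((1 + \<delta>) / \<delta>) ^ d\<rfloor>" if "P Y" for Y
      using bound[OF that] by linarith
  qed
  then obtain Y where PY: "P Y" and max: "\<And>Z. P Z \<Longrightarrow> card Z \<le> card Y"
    by blast
  have fin: "finite Y" using PY by (simp add: P_def)
  have "R \<subseteq> (\<Union>y\<in>Y. homothet (2 * \<delta>) y K)"
  proof (rule ccontr)
    assume "\<not> ?thesis"
    then obtain z where z: "z \<in> R" "\<And>y. y \<in> Y \<Longrightarrow> z \<notin> homothet (2 * \<delta>) y K"
      by blast
    \<comment> \<open>Then \<open>z\<close> could be added to \<open>Y\<close>, against its maximality.\<close>
    have zK: "homothet (2 * \<delta>) z K \<inter> Y = {}"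
      using z(2) homothet_sym by blast
    have "z \<notin> Y"
    proof
      assume "z \<in> Y"
      obtain k where "k \<in> K" using z(1) by (auto simp: R_def)
      \<comment> \<open>The midpoint of \<open>k\<close> and its reflection: the origin lies in \<open>K\<close>.\<close>
      then have "(\<lambda>i. 1/2 * k i + 1/2 * - k i) \<in> K"
        using symmetric_K by (intro convex_K) auto
      then have "z \<in> homothet (2 * \<delta>) z K"
        by (auto simp: mem_homothet intro: bexI[rotated])
      with zK \<open>z \<in> Y\<close> show False by auto
    qed
    moreover have "P (insert z Y)"
      using PY z zK by (auto simp: P_def separated_def)
    ultimately show False
      using max[of "insert z Y"] fin by simp
  qed
  then have "K \<subseteq> (\<Union>i<M. homothet (\<mu> + \<delta>) (x i) K) \<union> (\<Union>y\<in>Y. homothet (2 * \<delta>) y K)"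
    by (auto simp: R_def)
  moreover have "Y \<subseteq> E d" using PY subset_E by (auto simp: P_def R_def)
  ultimately show ?thesis
    using x fin bound[OF PY] unfolding q_def by blast
qed

text \<open>The case \<open>\<mu> = 1 - 2 * \<delta>\<close> of the two-scale cover. The big homothets have ratio \<open>1 - \<delta>\<close>, just below
  the excluded value 1, and cost at most 1 each.\<close>

lemma exists_cover_cost_le:
  assumes \<delta>: "0 < \<delta>" "\<delta> < 1/2" and \<alpha>: "0 \<le> \<alpha>"
  shows "\<exists>s\<in>cover_costs d \<alpha> K. s \<le> real M +
    (1 - ((1 - 2 * \<delta>) / (2 - \<delta>)) ^ d) ^ M * ((1 + \<delta>) / \<delta>) ^ d * (2 * \<delta>) powr \<alpha>"
proof -
  define \<mu> where "\<mu> = 1 - 2 * \<delta>"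
  have \<mu>: "\<mu> > 0" "\<mu> + \<delta> = 1 - \<delta>" "1 + \<delta> + \<mu> = 2 - \<delta>" using \<delta> by (auto simp: \<mu>_def)
  define q where "q = (1 - (\<mu> / (2 - \<delta>)) ^ d) ^ M * ((1 + \<delta>) / \<delta>) ^ d"
  obtain x Y where x: "\<forall>i<M. x i \<in> E d" and Y: "finite Y" "Y \<subseteq> E d" and
    cov: "K \<subseteq> (\<Union>i<M. homothet (1 - \<delta>) (x i) K) \<union> (\<Union>y\<in>Y. homothet (2 * \<delta>) y K)" and
    card: "real (card Y) \<le> q"
    using exists_two_scale_cover[OF \<delta>(1) \<mu>(1), of M] unfolding \<mu> q_def by blast
  obtain e where e: "bij_betw e {..<card Y} Y"
    using ex_bij_betw_nat_finite[OF Y(1)] by (auto simp: atLeast0LessThan)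
  define t where "t i = (if i < M then 1 - \<delta> else 2 * \<delta>)" for i
  define v where "v i = (if i < M then x i else e (i - M))" for i
  have vE: "v i \<in> E d" if "i < M + card Y" for i
    using that x Y(2) bij_betwE[OF e] by (auto simp: v_def)
  have "K \<subseteq> (\<Union>i<M + card Y. homothet (t i) (v i) K)"
  proof
    fix w assume "w \<in> K"
    with cov consider i where "i < M" "w \<in> homothet (1 - \<delta>) (x i) K"
      | y where "y \<in> Y" "w \<in> homothet (2 * \<delta>) y K"
      by blast
    then show "w \<in> (\<Union>i<M + card Y. homothet (t i) (v i) K)"
    proof cases
      case 1
      then show ?thesis by (intro UN_I[of i]) (auto simp: t_def v_def)
    next
      case 2
      then obtain j where "j < card Y" "e j = y"
        using e unfolding bij_betw_def by (metis imageE lessThan_iff)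
      with 2 show ?thesis by (intro UN_I[of "M + j"]) (auto simp: t_def v_def)
    qed
  qed
  moreover have "\<forall>i<M + card Y. 0 < t i \<and> t i < 1 \<and> v i \<in> E d"
    using vE \<delta> by (simp add: t_def)
  ultimately have mem: "(\<Sum>i<M + card Y. t i powr \<alpha>) \<in> cover_costs d \<alpha> K"
    unfolding cover_costs_def by blast
  have "(\<Sum>i<M + n. t i powr \<alpha>) = (\<Sum>i<M. t i powr \<alpha>) + (\<Sum>j<n. t (M + j) powr \<alpha>)" for n
    by (induction n) auto
  then have "(\<Sum>i<M + card Y. t i powr \<alpha>) =
      (\<Sum>i<M. t i powr \<alpha>) + (\<Sum>j<card Y. t (M + j) powr \<alpha>)" .
  also have "\<dots> = real M * (1 - \<delta>) powr \<alpha> + real (card Y) * (2 * \<delta>) powr \<alpha>"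
    by (simp add: t_def)
  also have "\<dots> \<le> real M * 1 + q * (2 * \<delta>) powr \<alpha>"
    using \<delta> \<alpha> card by (intro add_mono mult_left_mono mult_right_mono powr_le1) auto
  finally show ?thesis using mem by (auto simp: q_def \<mu>_def)
qed

text \<open>With \<open>p\<close> the fraction gained in one greedy step, about \<open>\<rho> / p\<close> big homothets reduce the
  uncovered part by the factor \<open>exp (- \<rho>)\<close>. The choice \<open>\<rho> = (d - \<alpha>) ln (1 / \<delta>)\<close> makes this
  \<open>\<delta> powr (d - \<alpha>)\<close>, which cancels against the product of the number \<open>((1 + \<delta>) / \<delta>) ^ d\<close> and the cost
  \<open>(2 * \<delta>) powr \<alpha>\<close> of the small homothets: together they cost only \<open>2 powr \<alpha> * (1 + \<delta>) ^ d\<close>. By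
  \<open>\<alpha> \<le> d - 1\<close> this is at most \<open>2 ^ d * (1 + \<delta>) ^ d / 2\<close>. The last summand \<open>(1 / 2) ^ d\<close> pays for rounding
  the number of big homothets up to an integer.\<close>

lemma exists_cheap_cover:
  assumes \<delta>: "0 < \<delta>" "\<delta> < 1/2" and \<alpha>: "0 \<le> \<alpha>" "\<alpha> \<le> real d - 1"
  shows "\<exists>s\<in>cover_costs d \<alpha> K. s \<le> 2 ^ d * (real d - \<alpha>) *
    (ln (1 / \<delta>) * ((2 - \<delta>) / (2 * (1 - 2 * \<delta>))) ^ d + (1 + \<delta>) ^ d / 2 + (1 / 2) ^ d)"
proof -
  define p where "p = ((1 - 2 * \<delta>) / (2 - \<delta>)) ^ d"
  have p: "0 < p" "p \<le> 1"
    unfolding p_def using \<delta> by (auto intro!: power_le_one)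
  define \<rho> where "\<rho> = (real d - \<alpha>) * ln (1 / \<delta>)"
  have \<rho>: "\<rho> \<ge> 0" unfolding \<rho>_def using \<delta> \<alpha> by (auto intro!: mult_nonneg_nonneg)
  define M where "M = nat \<lceil>\<rho> / p\<rceil>"
  have M: "\<rho> / p \<le> real M" "real M \<le> \<rho> / p + 1"
    using \<rho> p unfolding M_def by (auto simp: of_nat_nat)
  have "(1 - p) ^ M \<le> exp (- p) ^ M"
    using p exp_ge_add_one_self[of "- p"] by (intro power_mono) auto
  also have "\<dots> = exp (- (p * real M))"
    by (simp add: exp_of_nat_mult[symmetric] mult.commute)
  also have "\<dots> \<le> exp (- \<rho>)"
    using M(1) p by (simp add: field_simps)
  also have "\<dots> = \<delta> powr (real d - \<alpha>)"
    using \<delta> by (simp add: \<rho>_def powr_def ln_div)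
  finally have q: "(1 - p) ^ M \<le> \<delta> powr (real d - \<alpha>)" .
  have two: "a / b = 2 * (a / (2 * b))" for a b :: real by simp
  have "1 / p = ((2 - \<delta>) / (1 - 2 * \<delta>)) ^ d"
    by (simp add: p_def power_divide)
  also have "(2 - \<delta>) / (1 - 2 * \<delta>) = 2 * ((2 - \<delta>) / (2 * (1 - 2 * \<delta>)))"
    by (rule two)
  finally have inv_p: "1 / p = 2 ^ d * ((2 - \<delta>) / (2 * (1 - 2 * \<delta>))) ^ d"
    by (simp only: power_mult_distrib)
  have "(1 - p) ^ M * ((1 + \<delta>) / \<delta>) ^ d * (2 * \<delta>) powr \<alpha> \<le>
      \<delta> powr (real d - \<alpha>) * ((1 + \<delta>) / \<delta>) ^ d * (2 * \<delta>) powr \<alpha>"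
    using q \<delta> by (intro mult_right_mono) auto
  also have "\<dots> = 2 powr \<alpha> * (1 + \<delta>) ^ d"
    using \<delta> by (simp add: powr_diff powr_realpow power_divide powr_mult)
  also have "\<dots> \<le> 2 powr (real d - 1) * (1 + \<delta>) ^ d"
    using \<delta> \<alpha> by (intro mult_right_mono powr_mono) auto
  also have "\<dots> = 2 ^ d * ((1 + \<delta>) ^ d / 2)"
    by (simp add: powr_diff powr_realpow)
  finally have small: "(1 - p) ^ M * ((1 + \<delta>) / \<delta>) ^ d * (2 * \<delta>) powr \<alpha> \<le> 2 ^ d * ((1 + \<delta>) ^ d / 2)" .
  obtain s where s: "s \<in> cover_costs d \<alpha> K"
    and "s \<le> real M + (1 - p) ^ M * ((1 + \<delta>) / \<delta>) ^ d * (2 * \<delta>) powr \<alpha>"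
    unfolding p_def using exists_cover_cost_le[OF \<delta> \<alpha>(1), of M] by blast
  note this(2)
  also have "\<dots> \<le> (\<rho> * (1 / p) + 1) + 2 ^ d * ((1 + \<delta>) ^ d / 2)"
    using M(2) small by simp
  also have "\<dots> = (real d - \<alpha>) * (2 ^ d * (ln (1 / \<delta>) * ((2 - \<delta>) / (2 * (1 - 2 * \<delta>))) ^ d)) +
      1 * (2 ^ d * ((1 + \<delta>) ^ d / 2 + (1 / 2) ^ d))"
    unfolding inv_p \<rho>_def by (simp add: power_divide algebra_simps)
  also have "\<dots> \<le> (real d - \<alpha>) * (2 ^ d * (ln (1 / \<delta>) * ((2 - \<delta>) / (2 * (1 - 2 * \<delta>))) ^ d)) +
      (real d - \<alpha>) * (2 ^ d * ((1 + \<delta>) ^ d / 2 + (1 / 2) ^ d))"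
    using \<delta> \<alpha> by (intro add_left_mono mult_right_mono) auto
  also have "\<dots> = 2 ^ d * (real d - \<alpha>) *
      (ln (1 / \<delta>) * ((2 - \<delta>) / (2 * (1 - 2 * \<delta>))) ^ d + (1 + \<delta>) ^ d / 2 + (1 / 2) ^ d)"
    by (simp only: distrib_left mult_ac add_ac)
  finally show ?thesis
    using s by blast
qed

end

section \<open>Convex bodies as symmetric bodies\<close>

lemma compact_if_compactin:
  assumes "compactin (Euclidean_space d) B"
  shows "compact B" "B \<subseteq> E d"
  using assms by (auto simp: Euclidean_space_def compactin_subtopology euclidean_product_topology)

lemma emeasure_vol_compact:
  assumes "compact B" "B \<subseteq> E d"
  shows "emeasure (vol d) B < \<infinity>"
proof -
  define X where "X i = (if i < d then (\<lambda>x. x i) ` B else UNIV)" for i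
  have cpt: "compact ((\<lambda>x. x i) ` B)" for i
    using assms(1) continuous_on_subset[OF continuous_on_product_coordinates]
    by (intro compact_continuous_image) auto
  have X: "X i \<in> sets borel" for i
    using compact_imp_closed[OF cpt] by (auto simp: X_def)
  have "emeasure (vol d) B \<le> emeasure (vol d) (Pi\<^sub>E UNIV X)"
    using borel_box[of X, OF X] by (intro emeasure_mono) (auto simp: X_def PiE_iff)
  also have "\<dots> = (\<Prod>i<d. emeasure lborel (X i))"
    using X by (rule emeasure_vol_box) (auto simp: X_def)
  also have "\<dots> < \<infinity>"
    using emeasure_compact_finite[OF cpt] by (auto simp: X_def less_top[symmetric] ennreal_prod_eq_top)
  finally show ?thesis .
qed

lemma emeasure_lborel_open_pos:
  fixes S :: "real set"
  assumes "open S" "x \<in> S"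
  shows "emeasure lborel S > 0"
proof -
  obtain e where e: "e > 0" "{x - e<..<x + e} \<subseteq> S"
    using openE[OF assms] by (metis ball_eq_greaterThanLessThan)
  have "0 < emeasure lborel {x - e<..<x + e}"
    using e by simp
  also have "\<dots> \<le> emeasure lborel S"
    using assms e by (intro emeasure_mono) auto
  finally show ?thesis .
qed

text \<open>An interior point has a neighbourhood in the whole sequence space that is a product of open
  sets. Replacing its factors beyond the dimension by \<open>{0}\<close> leaves a subset of \<open>B\<close> whose volume is a
  finite product of positive lengths.\<close>

lemma emeasure_vol_interior_pos:
  assumes B: "B \<in> sets borel" and int: "Euclidean_space d interior_of B \<noteq> {}"
  shows "emeasure (vol d) B > 0"
proof -
  obtain x U where U: "openin (Euclidean_space d) U" "x \<in> U" "U \<subseteq> B"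
    using int by (auto simp: interior_of_def)
  then obtain V where V: "open V" "U = V \<inter> {x. \<forall>i\<ge>d. x i = 0}"
    by (auto simp: Euclidean_space_def openin_subtopology euclidean_product_topology)
  then have "openin (product_topology (\<lambda>i. euclidean) UNIV) V" "x \<in> V"
    using U by (auto simp: euclidean_product_topology)
  from product_topology_open_contains_basis[OF this] obtain X where
    X: "x \<in> Pi\<^sub>E UNIV X" "\<And>i. open (X i)" "Pi\<^sub>E UNIV X \<subseteq> V"
    by auto
  define Y where "Y i = (if i < d then X i else {0})" for i
  have Y: "Y i \<in> sets borel" for i
    using X(2) by (auto simp: Y_def)
  have "0 < (\<Prod>i<d. emeasure lborel (Y i))"
    using X(1) emeasure_lborel_open_pos[OF X(2)]
    by (auto simp: Y_def PiE_iff zero_less_iff_neq_zero)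
  also have "\<dots> = emeasure (vol d) (Pi\<^sub>E UNIV Y)"
    by (rule emeasure_vol_box[symmetric]) (use Y in \<open>auto simp: Y_def\<close>)
  also have "\<dots> \<le> emeasure (vol d) B"
  proof (rule emeasure_mono)
    have "y \<in> B" if y: "y \<in> Pi\<^sub>E UNIV Y" for y
    proof -
      have Yi: "y i \<in> Y i" for i using y by auto
      have "x i \<in> X i" for i
        using X(1) by auto
      moreover have "x i = 0" if "i \<ge> d" for i
        using U(2) V(2) that by auto
      ultimately have "y i \<in> X i" for i
        using Yi[of i] by (metis Y_def linorder_not_less singletonD)
      moreover have "y i = 0" if "i \<ge> d" for i
        using Yi[of i] that by (auto simp: Y_def)
      ultimately show ?thesis
        using X(3) V(2) U(3) by (auto simp: PiE_iff subset_iff)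
    qed
    then show "Pi\<^sub>E UNIV Y \<subseteq> B" by blast
  qed (use B in auto)
  finally show ?thesis .
qed

lemma symmetric_body_centred:
  assumes B: "convex_body d B" and c: "c \<in> E d" and sym: "\<And>x. x \<in> B \<Longrightarrow> (\<lambda>i. 2 * c i - x i) \<in> B"
  shows "symmetric_body d (homothet 1 (\<lambda>i. - c i) B)"
proof -
  let ?c = "\<lambda>i. - c i"
  have comp: "compact B" and BE: "B \<subseteq> E d"
    using B compact_if_compactin by (auto simp: convex_body_def)
  have borel: "B \<in> sets borel"
    using compact_imp_closed[OF comp] by simp
  have cE: "?c \<in> E d"
    using c by (simp add: E_iff)
  have vol: "emeasure (vol d) (homothet 1 ?c B) = emeasure (vol d) B"
    using emeasure_vol_homothet[OF _ cE borel, of 1] by simp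
  show ?thesis
  proof
    show "homothet 1 ?c B \<subseteq> E d"
      using BE cE by (fastforce simp: homothet_def E_iff)
    show "homothet 1 ?c B \<in> sets borel"
      using borel by (intro sets_homothet) auto
    show "0 < emeasure (vol d) (homothet 1 ?c B)"
      unfolding vol using borel B by (intro emeasure_vol_interior_pos) (auto simp: convex_body_def)
    show "emeasure (vol d) (homothet 1 ?c B) < \<infinity>"
      unfolding vol using comp BE by (rule emeasure_vol_compact)
    show "(\<lambda>i. - x i) \<in> homothet 1 ?c B" if x: "x \<in> homothet 1 ?c B" for x
    proof -
      obtain b where b: "b \<in> B" "x = (\<lambda>i. b i - c i)"
        using x by (auto simp: homothet_def)
      then show ?thesis
        unfolding homothet_def using sym[OF b(1)] by (intro image_eqI[of _ _ "\<lambda>i. 2 * c i - b i"]) auto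
    qed
    show "(\<lambda>i. u * x i + v * y i) \<in> homothet 1 ?c B"
      if xy: "x \<in> homothet 1 ?c B" "y \<in> homothet 1 ?c B" and uv: "0 \<le> u" "0 \<le> v" "u + v = 1" for x y u v
    proof -
      obtain a where a: "a \<in> B" "x = (\<lambda>i. 1 * a i + - c i)"
        using xy(1) unfolding mem_homothet by blast
      obtain b where b: "b \<in> B" "y = (\<lambda>i. 1 * b i + - c i)"
        using xy(2) unfolding mem_homothet by blast
      have "(\<lambda>i. u * a i + v * b i) \<in> B"
        using B a b uv unfolding convex_body_def by blast
      moreover have "(\<lambda>i. u * x i + v * y i) = (\<lambda>i. 1 * (u * a i + v * b i) + - c i)"
      proof
        fix i
        have "c i = u * c i + v * c i"
          using \<open>u + v = 1\<close> by (simp add: distrib_right[symmetric])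
        then show "u * x i + v * y i = 1 * (u * a i + v * b i) + - c i"
          by (simp add: a b algebra_simps)
      qed
      ultimately show ?thesis
        unfolding mem_homothet by (intro bexI[of _ "\<lambda>i. u * a i + v * b i"])
    qed
  qed
qed

text \<open>The ratios of a cover do not change when the body and the cover are moved together; this
  reduces the theorem to bodies centred at the origin.\<close>

lemma cover_costs_translate:
  assumes c: "c \<in> E d"
  shows "cover_costs d \<alpha> B \<subseteq> cover_costs d \<alpha> (homothet 1 c B)"
proof
  fix s assume "s \<in> cover_costs d \<alpha> B"
  then obtain k :: nat and t :: "nat \<Rightarrow> real" and v :: "nat \<Rightarrow> nat \<Rightarrow> real" where s: "s = (\<Sum>i<k. t i powr \<alpha>)"
    and tv: "\<forall>i<k. 0 < t i \<and> t i < 1 \<and> v i \<in> E d" and cov: "B \<subseteq> (\<Union>i<k. homothet (t i) (v i) B)"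
    unfolding cover_costs_def by blast
  define w where "w i j = v i j + c j - t i * c j" for i :: nat and j
  have "w i \<in> E d" if "i < k" for i
    using that tv c by (auto simp: w_def E_iff)
  moreover have "homothet 1 c B \<subseteq> (\<Union>i<k. homothet (t i) (w i) (homothet 1 c B))"
  proof
    fix x assume "x \<in> homothet 1 c B"
    then obtain b where b: "b \<in> B" "x = (\<lambda>i. b i + c i)"
      by (auto simp: homothet_def)
    then obtain i where ik: "i < k" "b \<in> homothet (t i) (v i) B"
      using cov by blast
    then obtain b' where i: "b' \<in> B" "b = (\<lambda>j. t i * b' j + v i j)"
      unfolding mem_homothet by blast
    have "x = (\<lambda>j. t i * (1 * b' j + c j) + w i j)"
      unfolding b i w_def by (auto simp: algebra_simps)
    moreover have "(\<lambda>j. 1 * b' j + c j) \<in> homothet 1 c B"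
      using i(1) unfolding mem_homothet by blast
    ultimately have "x \<in> homothet (t i) (w i) (homothet 1 c B)"
      unfolding mem_homothet[of x "t i"] by (intro bexI[of _ "\<lambda>j. 1 * b' j + c j"])
    with ik(1) show "x \<in> (\<Union>i<k. homothet (t i) (w i) (homothet 1 c B))"
      by blast
  qed
  ultimately show "s \<in> cover_costs d \<alpha> (homothet 1 c B)"
    unfolding cover_costs_def s using tv by blast
qed

lemma homothet_1_inverse: "homothet 1 c (homothet 1 (\<lambda>i. - c i) B) = B"
  by (simp add: homothet_def image_image)

section \<open>The bound for large dimension\<close>

text \<open>The value \<open>\<delta> = 1 / (d ln d)\<close> balances \<open>ln (1 / \<delta>)\<close> against the loss \<open>(1 + 3 \<delta> / 2 + \<dots>) ^ d\<close> in
  the big homothets. This loss adds \<open>3 / 2\<close> to the leading \<open>ln d + ln (ln d)\<close>, and the small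
  homothets add \<open>1 / 2\<close>. The summand 2 in the denominator of \<open>\<delta>\<close> keeps it below \<open>1 / 2\<close> from
  \<open>d = 2\<close> on and does not affect the limit.\<close>

theorem theorem8:
  shows "\<exists>\<epsilon> :: nat \<Rightarrow> real. \<epsilon> \<longlonglongrightarrow> 0 \<and>
    (\<forall>d\<ge>2. \<forall>\<alpha>::real. 0 \<le> \<alpha> \<and> \<alpha> \<le> real d - 1 \<longrightarrow>
      (\<forall>B. convex_body d B \<and> centrally_symmetric d B \<longrightarrow>
        g d \<alpha> B \<le> 2 ^ d * (real d - \<alpha>) * (ln (real d) + ln (ln (real d)) + 2 + \<epsilon> d)))"
proof -
  define \<delta> :: "nat \<Rightarrow> real" where "\<delta> d = 1 / (real d * ln (real d) + 2)" for d
  define C where "C d = ln (1 / \<delta> d) * ((2 - \<delta> d) / (2 * (1 - 2 * \<delta> d))) ^ d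
    + (1 + \<delta> d) ^ d / 2 + (1 / 2) ^ d" for d
  define \<epsilon> where "\<epsilon> d = C d - (ln (real d) + ln (ln (real d)) + 2)" for d
  have "\<epsilon> \<longlonglongrightarrow> 0"
    unfolding \<epsilon>_def C_def \<delta>_def by real_asymp
  moreover have "g d \<alpha> B \<le> 2 ^ d * (real d - \<alpha>) * (ln (real d) + ln (ln (real d)) + 2 + \<epsilon> d)"
    if d: "2 \<le> d" and \<alpha>: "0 \<le> \<alpha>" "\<alpha> \<le> real d - 1" and B: "convex_body d B" "centrally_symmetric d B"
    for d \<alpha> B
  proof -
    have "real d * ln (real d) > 0"
      using d by simp
    then have \<delta>: "0 < \<delta> d" "\<delta> d < 1 / 2"
      by (simp_all add: \<delta>_def field_simps)
    obtain c where c: "c \<in> E d" and sym: "\<And>x. x \<in> B \<Longrightarrow> (\<lambda>i. 2 * c i - x i) \<in> B"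
      using B(2) unfolding centrally_symmetric_def by blast
    interpret symmetric_body d "homothet 1 (\<lambda>i. - c i) B"
      using B(1) c sym by (rule symmetric_body_centred)
    obtain s where s: "s \<in> cover_costs d \<alpha> (homothet 1 (\<lambda>i. - c i) B)"
      and le: "s \<le> 2 ^ d * (real d - \<alpha>) * C d"
      unfolding C_def using exists_cheap_cover[OF \<delta> \<alpha>] by blast
    have "s \<in> cover_costs d \<alpha> B"
      using cover_costs_translate[OF c] s by (metis homothet_1_inverse subsetD)
    then have "g d \<alpha> B \<le> s"
      unfolding g_def by (rule cInf_lower) (rule bdd_below_cover_costs)
    also note le
    also have "C d = ln (real d) + ln (ln (real d)) + 2 + \<epsilon> d"
      by (simp add: \<epsilon>_def)
    finally show ?thesis .
  qed
  ultimately show ?thesis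
    by blast
qed

end
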